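(* Let $A_1,\dots,A_{m_1}$; $B_1,\dots,B_{n_1}$; $C_1,\dots,C_{n_1'}$; $D_1,\dots,D_{m_2}$; $E_1,\dots,E_{n_2}$; $F_1,\dots,F_{n_2'}$ be positive stable matrices in $\mathbb{C}^{r\times r}$ such that, for all admissible indices $p,q$, $A_pA_q=A_qA_p$, $A_pB_q=B_qA_p$, $A_pC_q=C_qA_p$, $B_pC_q=C_qB_p$, $F_pE_q=E_qF_p$, $F_qD_p=D_pF_q$, $D_pE_q=E_qD_p$, and such that $D_p+kI$, $E_p+kI$, $F_p+kI$ are invertible for all integers $k\ge 0$. Suppose that $A_i+kI$ is invertible for every $i=1,\dots,m_1$ and all integers $k\ge 0$. Let $s$ be a non-negative integer and $i\in\{1,\dots,m_1\}$. Then $$\Phi(A^{i},A_i+sI:B,C\mid D:E,F;x,y)=\sum_{k_1+k_2\le s}\binom{s}{k_1,k_2}[A^{i}]_{k_1+k_2}[B]_{k_1}[C]_{k_2}\,x^{k_1}y^{k_2}$$ $$\times\,\Phi(A+(k_1+k_2)I:B+k_1I,C+k_2I\mid D+(k_1+k_2)I:E+k_1I,F+k_2I;x,y)\,[D]^{-1}_{k_1+k_2}[E]^{-1}_{k_1}[F]^{-1}_{k_2}.$$ Furthermore, if $A_i-kI$ is invertible for integers $k\le s$, then $$\Phi(A^{i},A_i-sI:B,C\mid D:E,F;x,y)=\sum_{k_1+k_2\le s}\binom{s}{k_1,k_2}[A^{i}]_{k_1+k_2}[B]_{k_1}[C]_{k_2}\,(-x)^{k_1}(-y)^{k_2}$$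 $$\times\,\Phi(A^{i}+(k_1+k_2)I,A_i:B+k_1I,C+k_2I\mid D+(k_1+k_2)I:E+k_1I,F+k_2I;x,y)\,[D]^{-1}_{k_1+k_2}[E]^{-1}_{k_1}[F]^{-1}_{k_2}.$$ The sums run over integers $k_1,k_2\ge0$ with $k_1+k_2\le s$.
   Context: $I$ is the $r\times r$ identity matrix. A matrix is positive stable if all its eigenvalues have positive real part. For a square matrix $P$: $(P)_0=I$, $(P)_n=P(P+I)\cdots(P+(n-1)I)$ for $n\ge1$, and $(P)_n^{-1}$ is the inverse of $(P)_n$. $\binom{s}{k_1,k_2}=\frac{s!}{k_1!\,k_2!\,(s-k_1-k_2)!}$. For lists $A=(A_1,\dots,A_{m_1})$, $B=(B_1,\dots,B_{n_1})$, $C=(C_1,\dots,C_{n_1'})$, $D=(D_1,\dots,D_{m_2})$, $E=(E_1,\dots,E_{n_2})$, $F=(F_1,\dots,F_{n_2'})$ of $r\times r$ complex matrices, the Kampé de Fériet hypergeometric matrix function is $$\Phi(A:B,C\mid D:E,F;x,y)=\sum_{m,n\ge 0}\prod_{j=1}^{m_1}(A_j)_{m+n}\prod_{j=1}^{n_1}(B_j)_m\prod_{j=1}^{n_1'}(C_j)_n\prod_{j=1}^{m_2}(D_j)^{-1}_{m+n}\prod_{j=1}^{n_2}(E_j)^{-1}_m\prod_{j=1}^{n_2'}(F_j)^{-1}_n\,\frac{x^my^n}{m!\,n!},$$ with products in the order written and, within each product, in increasing order of the index from left to right; the same formula is used for shifted parameters whenever the inverses exist. For a list $A$: $A+kI$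 means adding $kI$ to every entry; $A^{i}$ is the list with $A_i$ removed; an argument $A^{i},P$ (resp. $A^{i}+kI,P$) stands for the list obtained from $A$ (resp. from $A+kI$) by replacing the $i$-th entry by $P$; $[A]_k=\prod_j(A_j)_k$, $[A]_k^{-1}=\prod_j(A_j)_k^{-1}$, $[A^{i}]_k=\prod_{j\ne i}(A_j)_k$. The same notation is used for the other lists. Here $x,y$ are complex numbers for which all the double series involved converge absolutely.
   Formalization: The matrices within each of the lists B, C, D, E, F are additionally assumed to commute with one another; without this the identities fail, e.g. for s=1, A=(I), D=(I,I), y=0 and two non-commuting matrices B_1, B_2. *)

theory Defs
  imports "HOL-Analysis.Analysis"
begin

type_synonym 'r cmat = "complex ^ 'r ^ 'r"

text \<open>
  Complex scalar multiplication of a matrix. (The library's \<open>*\<^sub>R\<close> only covers real scalars,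
  and \<open>*s\<close> only scales vectors; \<open>*\<close> on this type is the entrywise product and is not used.)
\<close>

definition cscale :: "complex \<Rightarrow> 'r cmat \<Rightarrow> 'r::finite cmat" (infixr "*\<^sub>m" 75) where
  "c *\<^sub>m M = map_matrix (\<lambda>z. c * z) M"

definition eigenvalue :: "'r::finite cmat \<Rightarrow> complex \<Rightarrow> bool" where
  "eigenvalue M c \<longleftrightarrow> (\<exists>v. v \<noteq> 0 \<and> M *v v = c *s v)"

definition positive_stable :: "'r::finite cmat \<Rightarrow> bool" where
  "positive_stable M \<longleftrightarrow> (\<forall>c. eigenvalue M c \<longrightarrow> Re c > 0)"

text \<open>
  Commutativity within a list is \<open>commute_lists Ps Ps\<close>. It is needed for every parameter list:
  \<open>[P]\<^sub>k [P + kI]\<^sub>m = [P]\<^bsub>k+m\<^esub>\<close> fails for lists with non-commuting entries.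
\<close>

definition commute_lists :: "'r::finite cmat list \<Rightarrow> 'r cmat list \<Rightarrow> bool" where
  "commute_lists Ps Qs \<longleftrightarrow> (\<forall>P\<in>set Ps. \<forall>Q\<in>set Qs. P ** Q = Q ** P)"

text \<open>\<open>shift k P = P + k I\<close>; \<open>mat c\<close> is the scalar matrix \<open>c I\<close>.\<close>

definition shift :: "int \<Rightarrow> 'r::finite cmat \<Rightarrow> 'r cmat" where
  "shift k P = P + mat (of_int k)"

primrec mat_poch :: "'r::finite cmat \<Rightarrow> nat \<Rightarrow> 'r cmat" where
  "mat_poch P 0 = mat 1"
| "mat_poch P (Suc n) = mat_poch P n ** shift (int n) P"

definition mat_poch_inv :: "'r::finite cmat \<Rightarrow> nat \<Rightarrow> 'r cmat" where
  "mat_poch_inv P n = matrix_inv (mat_poch P n)"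

text \<open>Ordered product \<open>M\<^sub>1 ** \<dots> ** M\<^sub>n\<close> of a list, indices increasing from left to right.\<close>

definition mat_prod :: "'r::finite cmat list \<Rightarrow> 'r cmat" where
  "mat_prod Ms = foldr (\<lambda>M N. M ** N) Ms (mat 1)"

definition list_poch :: "'r::finite cmat list \<Rightarrow> nat \<Rightarrow> 'r cmat" where
  "list_poch Ps k = mat_prod (map (\<lambda>P. mat_poch P k) Ps)"

text \<open>The factors are inverted one by one and are not reversed.\<close>

definition list_poch_inv :: "'r::finite cmat list \<Rightarrow> nat \<Rightarrow> 'r cmat" where
  "list_poch_inv Ps k = mat_prod (map (\<lambda>P. mat_poch_inv P k) Ps)"

definition shift_list :: "nat \<Rightarrow> 'r::finite cmat list \<Rightarrow> 'r cmat list" where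
  "shift_list k Ps = map (shift (int k)) Ps"

definition remove_nth :: "nat \<Rightarrow> 'a list \<Rightarrow> 'a list" where
  "remove_nth i xs = take i xs @ drop (Suc i) xs"

definition trinomial :: "nat \<Rightarrow> nat \<Rightarrow> nat \<Rightarrow> complex" where
  "trinomial s k1 k2 = fact s / (fact k1 * fact k2 * fact (s - k1 - k2))"

text \<open>The general term, and the sum, of the Kampe de Feriet hypergeometric matrix function.\<close>

definition kdf_term :: "'r::finite cmat list \<Rightarrow> 'r cmat list \<Rightarrow> 'r cmat list \<Rightarrow>
    'r cmat list \<Rightarrow> 'r cmat list \<Rightarrow> 'r cmat list \<Rightarrow> complex \<Rightarrow> complex \<Rightarrow> nat \<times> nat \<Rightarrow> 'r cmat" where
  "kdf_term A B C D E F x y = (\<lambda>(m, n).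
     (x ^ m * y ^ n / (fact m * fact n)) *\<^sub>m
       (list_poch A (m + n) ** list_poch B m ** list_poch C n **
        list_poch_inv D (m + n) ** list_poch_inv E m ** list_poch_inv F n))"

definition kdf :: "'r::finite cmat list \<Rightarrow> 'r cmat list \<Rightarrow> 'r cmat list \<Rightarrow>
    'r cmat list \<Rightarrow> 'r cmat list \<Rightarrow> 'r cmat list \<Rightarrow> complex \<Rightarrow> complex \<Rightarrow> 'r cmat" where
  "kdf A B C D E F x y = infsum (kdf_term A B C D E F x y) UNIV"

definition kdf_converges :: "'r::finite cmat list \<Rightarrow> 'r cmat list \<Rightarrow> 'r cmat list \<Rightarrow>
    'r cmat list \<Rightarrow> 'r cmat list \<Rightarrow> 'r cmat list \<Rightarrow> complex \<Rightarrow> complex \<Rightarrow> bool" where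
  "kdf_converges A B C D E F x y \<longleftrightarrow> (\<lambda>p. norm (kdf_term A B C D E F x y p)) summable_on UNIV"

end

theory Submission
  imports Defs
begin

text \<open>
  Write \<open>(P)\<^sub>N\<close> for the matrix Pochhammer symbol. The contiguous relation
  \<open>(P + I)\<^sub>N = (P)\<^sub>N + N (P + I)\<^bsub>N-1\<^esub>\<close>, iterated \<open>s\<close> times, gives the two finite expansions
  \<open>(P + s I)\<^sub>N = \<Sum>\<^sub>k binom(s,k) k! binom(N,k) (P + k I)\<^bsub>N-k\<^esub>\<close> and
  \<open>(P - s I)\<^sub>N = \<Sum>\<^sub>k binom(s,k) (-1)^k k! binom(N,k) (P)\<^bsub>N-k\<^esub>\<close>
  (lemmas \<open>mat_poch_shift_up\<close> and \<open>mat_poch_shift_down\<close>).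

  In the term of index \<open>(m, n)\<close> of the left-hand series the \<open>i\<close>-th numerator parameter contributes
  such a symbol with \<open>N = m + n\<close>. Vandermonde's identity writes \<open>binom(m+n,k)\<close> as the sum of
  \<open>binom(m,k1) binom(n,k2)\<close> over \<open>k1 + k2 = k\<close>, and these factors turn \<open>x^m y^n / (m! n!)\<close> into
  \<open>x^k1 y^k2 / (k1! k2!)\<close> times the coefficient of index \<open>(m - k1, n - k2)\<close>. The remaining
  symbols split by \<open>[P]\<^bsub>k+M\<^esub> = [P]\<^sub>k [P + k I]\<^sub>M\<close>, and commutativity moves the factors that depend
  only on \<open>k1\<close> and \<open>k2\<close> out to the left and to the right (\<open>kdf_product_split\<close>). So every term on
  the left is a finite combination of terms of index \<open>(m - k1, n - k2)\<close> of the series on the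
  right. Summing over \<open>m\<close> and \<open>n\<close> finishes the proof, since translating the index does not change
  an unconditional sum and multiplication by fixed matrices is continuous (\<open>kdf_expansion\<close>).
\<close>

section \<open>Complex scalar multiples and infinite sums of matrices\<close>

lemma cscale_eq_mat_mult: "c *\<^sub>m M = mat c ** M"
  by (simp add: cscale_def vec_eq_iff matrix_matrix_mult_def mat_def if_distrib if_distribR
      sum.delta cong: if_cong)

lemma matrix_mult_mat: "M ** mat c = c *\<^sub>m (M :: 'r::finite cmat)"
  by (simp add: cscale_def vec_eq_iff matrix_matrix_mult_def mat_def if_distrib if_distribR
      sum.delta mult.commute cong: if_cong)

lemma cscale_mult_left: "(c *\<^sub>m M) ** N = c *\<^sub>m (M ** N)"
  by (simp add: cscale_eq_mat_mult matrix_mul_assoc)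

lemma cscale_mult_right: "M ** (c *\<^sub>m N) = c *\<^sub>m (M ** N)"
  by (simp add: matrix_mult_mat[symmetric] matrix_mul_assoc)

lemma cscale_cscale: "c *\<^sub>m (d *\<^sub>m M) = (c * d) *\<^sub>m M"
  by (simp add: cscale_def vec_eq_iff)

lemma cscale_zero_left [simp]: "0 *\<^sub>m M = 0"
  by (simp add: cscale_def vec_eq_iff)

lemma cscale_one_left [simp]: "1 *\<^sub>m M = M"
  by (simp add: cscale_def vec_eq_iff)

lemma cscale_add_left: "(c + d) *\<^sub>m M = c *\<^sub>m M + d *\<^sub>m M"
  by (simp add: cscale_def vec_eq_iff algebra_simps)

lemma cscale_sum_left: "(\<Sum>k\<in>S. f k) *\<^sub>m M = (\<Sum>k\<in>S. f k *\<^sub>m M)"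
  by (simp add: cscale_def vec_eq_iff sum_distrib_right)

lemma cscale_sum_right: "c *\<^sub>m (\<Sum>k\<in>S. f k) = (\<Sum>k\<in>S. c *\<^sub>m f k)"
  by (simp add: cscale_def vec_eq_iff sum_distrib_left)

lemma matrix_add_rdistrib: "(M + N) ** (K :: 'r::finite cmat) = M ** K + N ** K"
  by (simp add: matrix_matrix_mult_def vec_eq_iff algebra_simps sum.distrib)

lemma matrix_mult_zero [simp]: "M ** (0 :: 'r::finite cmat) = 0" "(0 :: 'r cmat) ** M = 0"
  by (simp_all add: matrix_matrix_mult_def vec_eq_iff)

lemma matrix_mult_sum_left: "(\<Sum>k\<in>S. f k) ** M = (\<Sum>k\<in>S. f k ** (M :: 'r::finite cmat))"
  by (induction S rule: infinite_finite_induct)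
     (simp_all add: matrix_add_rdistrib)

lemma matrix_mult_sum_right: "M ** (\<Sum>k\<in>S. f k) = (\<Sum>k\<in>S. (M :: 'r::finite cmat) ** f k)"
  by (induction S rule: infinite_finite_induct)
     (simp_all add: matrix_add_ldistrib)

lemma bounded_linear_cscale_sandwich:
  fixes L R :: "'r::finite cmat"
  shows "bounded_linear (\<lambda>M. c *\<^sub>m (L ** M ** R))"
  unfolding linear_conv_bounded_linear[symmetric]
proof (rule linearI)
  show "c *\<^sub>m (L ** (M + N) ** R) = c *\<^sub>m (L ** M ** R) + c *\<^sub>m (L ** N ** R)" for M N
    by (simp add: cscale_eq_mat_mult matrix_add_ldistrib matrix_add_rdistrib)
  show "c *\<^sub>m (L ** (t *\<^sub>R M) ** R) = t *\<^sub>R (c *\<^sub>m (L ** M ** R))" for t M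
  proof -
    have scaleR_cscale: "u *\<^sub>R X = complex_of_real u *\<^sub>m X" for u and X :: "'r cmat"
      by (simp add: cscale_def vec_eq_iff scaleR_conv_of_real[where 'a = complex])
    show ?thesis
      by (simp add: scaleR_cscale cscale_mult_left cscale_mult_right cscale_cscale mult.commute)
  qed
qed

lemma has_sum_translate:
  fixes g :: "nat \<times> nat \<Rightarrow> 'a::{comm_monoid_add, topological_space}"
  assumes "(g has_sum S) UNIV"
  shows "((\<lambda>(m, n). if k \<le> m \<and> l \<le> n then g (m - k, n - l) else 0) has_sum S) UNIV"
proof -
  define h where "h = (\<lambda>(a, b). (a + k, b + l))"
  define f where "f = (\<lambda>(m, n). if k \<le> m \<and> l \<le> n then g (m - k, n - l) else 0)"
  have inj: "inj h" by (auto simp: h_def inj_on_def)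
  have "f \<circ> h = g" by (auto simp: fun_eq_iff f_def h_def)
  then have "(f has_sum S) (range h)"
    using assms by (simp add: has_sum_reindex[OF inj])
  moreover have "f p = 0" if "p \<notin> range h" for p
  proof (rule ccontr)
    assume "f p \<noteq> 0"
    then have "p = h (fst p - k, snd p - l)"
      by (auto simp: f_def h_def split: prod.splits if_splits)
    with that show False by blast
  qed
  ultimately have "(f has_sum S) UNIV"
    using has_sum_cong_neutral[of UNIV "range h" f f S] by auto
  then show ?thesis by (simp add: f_def)
qed

lemma has_sum_finite_sum:
  fixes f :: "'b \<Rightarrow> 'a \<Rightarrow> 'c::{topological_comm_monoid_add}"
  assumes "finite K" "\<And>k. k \<in> K \<Longrightarrow> (f k has_sum S k) U"
  shows "((\<lambda>p. \<Sum>k\<in>K. f k p) has_sum (\<Sum>k\<in>K. S k)) U"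
  using assms by (induction K rule: finite_induct) (auto intro: has_sum_add)

section \<open>Commuting matrices\<close>

text \<open>Commutativity as a predicate, so that its closure properties can be used as rules.\<close>

definition mat_commute :: "'r::finite cmat \<Rightarrow> 'r cmat \<Rightarrow> bool" where
  "mat_commute X Y \<longleftrightarrow> X ** Y = Y ** X"

lemma mat_commute_sym: "mat_commute X Y \<Longrightarrow> mat_commute Y X"
  by (simp add: mat_commute_def)

lemma mat_commute_refl [simp]: "mat_commute X X"
  by (simp add: mat_commute_def)

lemma mat_commute_mat [simp]: "mat_commute X (mat c)"
  by (simp add: mat_commute_def matrix_mult_mat cscale_eq_mat_mult)

lemma mat_commute_left: "mat_commute X Y \<Longrightarrow> X ** (Y ** Z) = Y ** (X ** Z)"
  by (simp add: mat_commute_def matrix_mul_assoc)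

lemma mat_commute_mult:
  "mat_commute X Y \<Longrightarrow> mat_commute X Z \<Longrightarrow> mat_commute X (Y ** Z)"
  unfolding mat_commute_def by (metis matrix_mul_assoc)

lemma mat_commute_shift: "mat_commute X Y \<Longrightarrow> mat_commute X (shift k Y)"
  using mat_commute_mat[of X "of_int k"]
  by (simp add: mat_commute_def shift_def matrix_add_ldistrib matrix_add_rdistrib)

lemma mat_commute_poch: "mat_commute X Y \<Longrightarrow> mat_commute X (mat_poch Y n)"
  by (induction n) (simp_all add: mat_commute_mult mat_commute_shift)

lemma matrix_inv_eq:
  fixes X :: "'r::finite cmat"
  assumes "X ** Y = mat 1" "Y ** X = mat 1"
  shows "matrix_inv X = Y"
  unfolding matrix_inv_def
  by (rule some_equality) (use assms in \<open>auto, metis matrix_mul_assoc matrix_mul_lid matrix_mul_rid\<close>)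

lemma matrix_inv_inverse:
  fixes X :: "'r::finite cmat"
  assumes "invertible X"
  shows "X ** matrix_inv X = mat 1" "matrix_inv X ** X = mat 1"
  using assms matrix_inv_eq[of X] unfolding invertible_def by auto

lemma matrix_inv_mult:
  fixes X Y :: "'r::finite cmat"
  assumes "invertible X" "invertible Y"
  shows "matrix_inv (X ** Y) = matrix_inv Y ** matrix_inv X"
proof (rule matrix_inv_eq)
  show "X ** Y ** (matrix_inv Y ** matrix_inv X) = mat 1"
    by (metis assms matrix_inv_inverse(1) matrix_mul_assoc matrix_mul_rid)
  show "matrix_inv Y ** matrix_inv X ** (X ** Y) = mat 1"
    by (metis assms matrix_inv_inverse(2) matrix_mul_assoc matrix_mul_rid)
qed

lemma mat_commute_inv:
  assumes "invertible Y" "mat_commute X Y"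
  shows "mat_commute X (matrix_inv Y)"
  using assms matrix_inv_inverse[OF assms(1)] unfolding mat_commute_def
  by (metis matrix_mul_assoc matrix_mul_lid matrix_mul_rid)

lemma mat_prod_simps [simp]:
  "mat_prod [] = mat 1" "mat_prod (M # Ms) = M ** mat_prod Ms"
  by (simp_all add: mat_prod_def)

lemma mat_prod_append: "mat_prod (Ms @ Ns) = mat_prod Ms ** mat_prod Ns"
  by (induction Ms) (simp_all add: matrix_mul_assoc)

lemma mat_commute_mat_prod:
  "(\<And>M. M \<in> set Ms \<Longrightarrow> mat_commute X M) \<Longrightarrow> mat_commute X (mat_prod Ms)"
  by (induction Ms) (simp_all add: mat_commute_mult)

lemma mat_prod_map_mult:
  assumes "\<And>P Q. P \<in> set Ps \<Longrightarrow> Q \<in> set Ps \<Longrightarrow> mat_commute (g P) (f Q)"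
  shows "mat_prod (map (\<lambda>P. f P ** g P) Ps) = mat_prod (map f Ps) ** mat_prod (map g Ps)"
  using assms
proof (induction Ps)
  case (Cons P Ps)
  have comm: "mat_commute (g P) (mat_prod (map f Ps))"
    by (rule mat_commute_mat_prod) (use Cons.prems in auto)
  have "mat_prod (map (\<lambda>P. f P ** g P) Ps) = mat_prod (map f Ps) ** mat_prod (map g Ps)"
    by (rule Cons.IH) (use Cons.prems in auto)
  then show ?case
    by (simp add: matrix_mul_assoc[symmetric] mat_commute_left[OF comm])
qed simp

section \<open>Pochhammer symbols of matrices and of lists\<close>

lemma shift_0 [simp]: "shift 0 P = P"
  by (simp add: shift_def)

lemma shift_shift: "shift a (shift b P) = shift (a + b) P"
  by (simp add: shift_def vec_eq_iff mat_def algebra_simps)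

lemma mat_poch_add: "mat_poch P (k + n) = mat_poch P k ** mat_poch (shift (int k) P) n"
  by (induction n) (simp_all add: matrix_mul_assoc shift_shift add.commute)

lemma invertible_mat_poch:
  "(\<And>k::nat. invertible (shift (int k) P)) \<Longrightarrow> invertible (mat_poch P n)"
proof (induction n)
  case 0
  show ?case by (simp add: invertible_def)
qed (simp add: invertible_mult)

lemma mat_poch_inv_add:
  assumes "\<And>k::nat. invertible (shift (int k) P)"
  shows "mat_poch_inv P (k + n) = mat_poch_inv (shift (int k) P) n ** mat_poch_inv P k"
proof -
  have "invertible (shift (int j) (shift (int k) P))" for j
    using assms[of "j + k"] by (simp add: shift_shift)
  then show ?thesis
    unfolding mat_poch_inv_def mat_poch_add
    by (intro matrix_inv_mult invertible_mat_poch assms)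
qed

lemma mat_commute_poch_inv:
  assumes "\<And>k::nat. invertible (shift (int k) Y)" "mat_commute X Y"
  shows "mat_commute X (mat_poch_inv Y n)"
  unfolding mat_poch_inv_def
  by (intro mat_commute_inv mat_commute_poch invertible_mat_poch assms)

lemma mat_commute_list_poch:
  "(\<And>P. P \<in> set Ps \<Longrightarrow> mat_commute X P) \<Longrightarrow> mat_commute X (list_poch Ps n)"
  unfolding list_poch_def by (rule mat_commute_mat_prod) (auto intro: mat_commute_poch)

lemma mat_commute_list_poch_inv:
  assumes "\<And>P k. P \<in> set Ps \<Longrightarrow> invertible (shift (int k) P)"
    and "\<And>P. P \<in> set Ps \<Longrightarrow> mat_commute X P"
  shows "mat_commute X (list_poch_inv Ps n)"
  unfolding list_poch_inv_def
  by (rule mat_commute_mat_prod) (use assms in \<open>auto intro: mat_commute_poch_inv\<close>)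

lemma commute_listsD: "commute_lists Ps Qs \<Longrightarrow> P \<in> set Ps \<Longrightarrow> Q \<in> set Qs \<Longrightarrow> mat_commute P Q"
  by (auto simp: commute_lists_def mat_commute_def)

lemma commute_lists_list_poch:
  assumes "commute_lists Ps Qs"
  shows "mat_commute (list_poch (shift_list a Ps) k) (list_poch (shift_list b Qs) l)"
  by (intro mat_commute_list_poch mat_commute_sym[OF mat_commute_list_poch])
     (auto simp: shift_list_def intro!: mat_commute_shift mat_commute_sym[OF mat_commute_shift]
       dest: commute_listsD[OF assms])

lemma commute_lists_list_poch_inv:
  assumes "commute_lists Ps Qs"
    and "\<And>P k. P \<in> set Ps \<union> set Qs \<Longrightarrow> invertible (shift (int k) P)"
  shows "mat_commute (list_poch_inv (shift_list a Ps) k) (list_poch_inv (shift_list b Qs) l)"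
proof -
  have inv: "invertible (shift (int j) (shift (int c) P))" if "P \<in> set Ps \<union> set Qs" for P j c
    using assms(2)[OF that, of "j + c"] by (simp add: shift_shift)
  have "mat_commute P Q" if "P \<in> set (shift_list a Ps)" "Q \<in> set (shift_list b Qs)" for P Q
    using that by (auto simp: shift_list_def intro!: mat_commute_shift
        mat_commute_sym[OF mat_commute_shift] dest: commute_listsD[OF assms(1)])
  moreover have "invertible (shift (int j) P)"
    if "P \<in> set (shift_list a Ps) \<union> set (shift_list b Qs)" for P j
    using that inv by (auto simp: shift_list_def)
  ultimately show ?thesis
    by (intro mat_commute_list_poch_inv mat_commute_sym[OF mat_commute_list_poch_inv])
       (auto intro: mat_commute_sym)
qed

lemma shift_list_0 [simp]: "shift_list 0 Ps = Ps"
  by (simp add: shift_list_def map_idI)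

lemma list_poch_add:
  assumes "commute_lists Ps Ps"
  shows "list_poch Ps (k + n) = list_poch Ps k ** list_poch (shift_list k Ps) n"
proof -
  have "mat_commute (mat_poch (shift (int k) P) n) (mat_poch Q k)"
    if "P \<in> set Ps" "Q \<in> set Ps" for P Q
    using commute_listsD[OF assms that]
    by (intro mat_commute_poch mat_commute_sym[OF mat_commute_poch] mat_commute_shift)
       (rule mat_commute_sym)
  from mat_prod_map_mult[of Ps, OF this] show ?thesis
    by (simp add: list_poch_def shift_list_def mat_poch_add o_def)
qed

lemma list_poch_inv_add:
  assumes "commute_lists Ps Ps" "\<And>P k. P \<in> set Ps \<Longrightarrow> invertible (shift (int k) P)"
  shows "list_poch_inv Ps (k + n) = list_poch_inv (shift_list k Ps) n ** list_poch_inv Ps k"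
proof -
  have inv: "invertible (shift (int j) (shift (int c) P))" if "P \<in> set Ps" for P j c
    using assms(2)[OF that, of "j + c"] by (simp add: shift_shift)
  have "mat_commute (mat_poch_inv P k) (mat_poch_inv (shift (int k) Q) n)"
    if "P \<in> set Ps" "Q \<in> set Ps" for P Q
    using commute_listsD[OF assms(1) that] that assms(2) inv
    by (intro mat_commute_poch_inv mat_commute_sym[OF mat_commute_poch_inv] mat_commute_shift)
       (auto intro: mat_commute_sym)
  from mat_prod_map_mult[of Ps, OF this]
  have "mat_prod (map (\<lambda>P. mat_poch_inv (shift (int k) P) n ** mat_poch_inv P k) Ps)
      = list_poch_inv (shift_list k Ps) n ** list_poch_inv Ps k"
    by (simp add: list_poch_inv_def shift_list_def o_def)
  moreover have "map (\<lambda>P. mat_poch_inv P (k + n)) Ps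
      = map (\<lambda>P. mat_poch_inv (shift (int k) P) n ** mat_poch_inv P k) Ps"
    using assms(2) by (simp add: mat_poch_inv_add)
  ultimately show ?thesis by (simp only: list_poch_inv_def)
qed

text \<open>
  Replacing the \<open>i\<close>-th entry puts \<open>Q\<close> in the middle of the ordered product; it is moved to the end,
  so that the remaining entries form the list without index \<open>i\<close>.
\<close>

lemma list_poch_update:
  assumes "i < length A" "\<And>P. P \<in> set A \<Longrightarrow> mat_commute Q P"
  shows "list_poch (A[i := Q]) n = list_poch (remove_nth i A) n ** mat_poch Q n"
proof -
  have "mat_commute (mat_poch Q n) (list_poch (drop (Suc i) A) n)"
    using assms(2) by (intro mat_commute_list_poch mat_commute_sym[OF mat_commute_poch])
      (auto dest: in_set_dropD intro: mat_commute_sym)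
  then show ?thesis
    using assms(1)
    by (simp add: list_poch_def upd_conv_take_nth_drop remove_nth_def mat_prod_append
        mat_commute_def matrix_mul_assoc[symmetric])
qed

lemma shift_list_remove_nth: "remove_nth i (shift_list k A) = shift_list k (remove_nth i A)"
  by (simp add: remove_nth_def shift_list_def take_map drop_map)

lemma commute_lists_subset:
  "commute_lists Ps Qs \<Longrightarrow> set Ps' \<subseteq> set Ps \<Longrightarrow> set Qs' \<subseteq> set Qs \<Longrightarrow> commute_lists Ps' Qs'"
  unfolding commute_lists_def by blast

lemma set_remove_nth_subset: "set (remove_nth i A) \<subseteq> set A"
  by (auto simp: remove_nth_def dest: in_set_takeD in_set_dropD)

section \<open>Iterated contiguous relations\<close>

text \<open>
  In the recurrence a unit step in \<open>s\<close> costs one step in \<open>N\<close>. The index \<open>j\<close> follows the shift of the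
  parameter: for \<open>\<epsilon> = 1\<close> the sequence of interest is \<open>(P + (s + j) I)\<^sub>N\<close>, whereas
  for \<open>\<epsilon> = -1\<close> it is \<open>(P - s I)\<^sub>N\<close>, which does not depend on \<open>j\<close>.
\<close>

lemma iterated_contiguous:
  fixes a :: "nat \<Rightarrow> nat \<Rightarrow> nat \<Rightarrow> 'r::finite cmat" and \<epsilon> :: complex
  assumes rec: "\<And>s j N. a (Suc s) j N = a s j N + (\<epsilon> * of_nat N) *\<^sub>m a s (Suc j) (N - 1)"
  shows "a s j N = (\<Sum>k\<le>s. (of_nat (s choose k) * (\<epsilon> ^ k * of_nat (fact k * (N choose k)))) *\<^sub>m
    a 0 (j + k) (N - k))"
proof (induction s arbitrary: j N)
  case (Suc s)
  define f where "f k = (\<epsilon> ^ k * of_nat (fact k * (N choose k))) *\<^sub>m a 0 (j + k) (N - k)" for k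
  have step: "(\<epsilon> * of_nat N) *\<^sub>m ((c * (\<epsilon> ^ k * of_nat (fact k * ((N - 1) choose k)))) *\<^sub>m
      a 0 (Suc j + k) (N - 1 - k)) = c *\<^sub>m f (Suc k)" for c k
  proof -
    have "N * (fact k * ((N - 1) choose k)) = fact (Suc k) * (N choose Suc k)"
      using binomial_absorption[of k N] by (metis fact_Suc mult.assoc mult.left_commute of_nat_id)
    then have "complex_of_nat N * of_nat (fact k * ((N - 1) choose k)) =
        of_nat (fact (Suc k) * (N choose Suc k))"
      by (metis of_nat_mult)
    then have "\<epsilon> * of_nat N * (c * (\<epsilon> ^ k * of_nat (fact k * ((N - 1) choose k)))) =
        c * (\<epsilon> ^ Suc k * of_nat (fact (Suc k) * (N choose Suc k)))"
      by (metis (no_types, opaque_lifting) mult.assoc mult.left_commute power_Suc)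
    then show ?thesis by (simp only: f_def cscale_cscale) simp
  qed
  have "a (Suc s) j N = (\<Sum>k\<le>s. of_nat (s choose k) *\<^sub>m f k)
      + (\<Sum>k\<le>s. of_nat (s choose k) *\<^sub>m f (Suc k))"
    unfolding rec Suc.IH[of j N] Suc.IH[of "Suc j" "N - 1"] cscale_sum_right step
    by (simp add: f_def cscale_cscale)
  also have "(\<Sum>k\<le>s. of_nat (s choose k) *\<^sub>m f k) = (\<Sum>k\<le>Suc s. of_nat (s choose k) *\<^sub>m f k)"
    by (simp add: binomial_eq_0)
  also have "\<dots> + (\<Sum>k\<le>s. of_nat (s choose k) *\<^sub>m f (Suc k))
      = (\<Sum>k\<le>Suc s. of_nat (Suc s choose k) *\<^sub>m f k)"
    unfolding sum.atMost_Suc_shift by (simp add: cscale_add_left sum.distrib)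
  finally show ?case by (simp add: f_def cscale_cscale)
qed simp

lemma mat_poch_shift_1:
  "mat_poch (shift 1 P) N = mat_poch P N + of_nat N *\<^sub>m mat_poch (shift 1 P) (N - 1)"
proof (cases N)
  case (Suc n)
  let ?Q = "mat_poch (shift 1 P) n"
  have "mat_poch P N = P ** ?Q"
    using mat_poch_add[of P 1 n] Suc by simp
  also have "\<dots> = ?Q ** P"
    using mat_commute_poch[OF mat_commute_shift[OF mat_commute_refl[of P]]]
    by (simp add: mat_commute_def)
  finally have "mat_poch P N + of_nat N *\<^sub>m ?Q = ?Q ** (P + mat (of_nat N))"
    by (simp add: matrix_add_ldistrib matrix_mult_mat)
  also have "P + mat (of_nat N) = shift (int n) (shift 1 P)"
    by (simp add: Suc shift_def vec_eq_iff mat_def)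
  finally show ?thesis using Suc by simp
qed simp

lemma mat_poch_shift_up:
  "mat_poch (shift (int s) P) N =
    (\<Sum>k\<le>s. (of_nat (s choose k) * (1 ^ k * of_nat (fact k * (N choose k)))) *\<^sub>m
      mat_poch (shift (int k) P) (N - k))"
proof -
  have rec: "mat_poch (shift (int (Suc s + j)) P) N = mat_poch (shift (int (s + j)) P) N
      + (1 * of_nat N) *\<^sub>m mat_poch (shift (int (s + Suc j)) P) (N - 1)" for s j N
    using mat_poch_shift_1[of "shift (int (s + j)) P" N] by (simp add: shift_shift ac_simps)
  show ?thesis
    using iterated_contiguous[of "\<lambda>s j N. mat_poch (shift (int (s + j)) P) N" 1 s 0 N, OF rec]
    by simp
qed

lemma mat_poch_shift_down:
  "mat_poch (shift (- int s) P) N =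
    (\<Sum>k\<le>s. (of_nat (s choose k) * ((-1) ^ k * of_nat (fact k * (N choose k)))) *\<^sub>m
      mat_poch P (N - k))"
proof -
  have rec: "mat_poch (shift (- int (Suc s)) P) N = mat_poch (shift (- int s) P) N
      + (- 1 * of_nat N) *\<^sub>m mat_poch (shift (- int s) P) (N - 1)" for s N
    using mat_poch_shift_1[of "shift (- int (Suc s)) P" N]
    by (simp add: shift_shift cscale_def vec_eq_iff)
  show ?thesis
    using iterated_contiguous[of "\<lambda>s j N. mat_poch (shift (- int s) P) N" "-1" s 0 N, OF rec]
    by simp
qed

section \<open>Expansion of the hypergeometric function\<close>

lemma kdf_coefficient_split:
  assumes "k1 + k2 \<le> s"
  shows "x ^ m * y ^ n / (fact m * fact n) *
      (of_nat (s choose (k1 + k2)) * (\<epsilon> ^ (k1 + k2) *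
        of_nat (fact (k1 + k2) * ((m choose k1) * (n choose k2))))) =
    (if k1 \<le> m \<and> k2 \<le> n
     then trinomial s k1 k2 * (\<epsilon> * x) ^ k1 * (\<epsilon> * y) ^ k2 *
       (x ^ (m - k1) * y ^ (n - k2) / (fact (m - k1) * fact (n - k2))) else 0)"
proof (cases "k1 \<le> m \<and> k2 \<le> n")
  case True
  then obtain a b where m: "m = k1 + a" and n: "n = k2 + b"
    by (auto simp: le_iff_add)
  obtain c where s: "s = k1 + k2 + c"
    using assms by (auto simp: le_iff_add)
  show ?thesis
    by (simp add: m n s trinomial_def binomial_fact power_add power_mult_distrib field_simps)
qed (auto simp: not_le)

text \<open>
  The factors belonging to the shifts can be pulled out of the term: the first three to the left
  because \<open>A\<close>, \<open>B\<close>, \<open>C\<close> commute with each other, the last three to the right because \<open>D\<close>, \<open>E\<close>, \<open>F\<close> do.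
\<close>

lemma kdf_product_split:
  fixes A B C D E F :: "'r::finite cmat list"
  assumes AA: "commute_lists A A" and AB: "commute_lists A B" and AC: "commute_lists A C"
    and BC: "commute_lists B C"
    and FE: "commute_lists F E" and DF: "commute_lists D F" and DE: "commute_lists D E"
    and BB: "commute_lists B B" and CC: "commute_lists C C"
    and DD: "commute_lists D D" and EE: "commute_lists E E" and FF: "commute_lists F F"
    and inv: "\<And>P k. P \<in> set D \<union> set E \<union> set F \<Longrightarrow> invertible (shift (int k) P)"
    and i: "i < length A"
    and Q: "\<And>P. P \<in> set A \<union> set B \<union> set C \<Longrightarrow> mat_commute Q P"
  shows "list_poch (remove_nth i A) (k1 + k2 + (a + b)) ** mat_poch Q (a + b) **
      list_poch B (k1 + a) ** list_poch C (k2 + b) ** list_poch_inv D (k1 + k2 + (a + b)) **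
      list_poch_inv E (k1 + a) ** list_poch_inv F (k2 + b) =
    list_poch (remove_nth i A) (k1 + k2) ** list_poch B k1 ** list_poch C k2 **
      (list_poch ((shift_list (k1 + k2) A)[i := Q]) (a + b) **
       list_poch (shift_list k1 B) a ** list_poch (shift_list k2 C) b **
       list_poch_inv (shift_list (k1 + k2) D) (a + b) **
       list_poch_inv (shift_list k1 E) a ** list_poch_inv (shift_list k2 F) b) **
      (list_poch_inv D (k1 + k2) ** list_poch_inv E k1 ** list_poch_inv F k2)"
proof -
  define R where "R = remove_nth i A"
  note sub = set_remove_nth_subset[of i A, folded R_def]
  have RR: "commute_lists R R" and RB: "commute_lists R B" and RC: "commute_lists R C"
    using sub by (auto intro: commute_lists_subset[OF AA] commute_lists_subset[OF AB]
        commute_lists_subset[OF AC])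
  define k where "k = k1 + k2"
  define M where "M = a + b"
  define Rk Bk Ck where "Rk = list_poch R k" and "Bk = list_poch B k1" and "Ck = list_poch C k2"
  define R' Q' B' C' where "R' = list_poch (shift_list k R) M" and "Q' = mat_poch Q M"
    and "B' = list_poch (shift_list k1 B) a" and "C' = list_poch (shift_list k2 C) b"
  define Dk Ek Fk where "Dk = list_poch_inv D k" and "Ek = list_poch_inv E k1"
    and "Fk = list_poch_inv F k2"
  define D' E' F' where "D' = list_poch_inv (shift_list k D) M"
    and "E' = list_poch_inv (shift_list k1 E) a" and "F' = list_poch_inv (shift_list k2 F) b"
  have QB: "mat_commute Q' Bk" and QC: "mat_commute Q' Ck"
    unfolding Q'_def Bk_def Ck_def
    by (intro mat_commute_list_poch mat_commute_sym[OF mat_commute_poch] mat_commute_sym[OF Q];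
        simp)+
  have R'B: "mat_commute R' Bk" and R'C: "mat_commute R' Ck" and B'C: "mat_commute B' Ck"
    using commute_lists_list_poch[OF RB, of k M 0 k1] commute_lists_list_poch[OF RC, of k M 0 k2]
      commute_lists_list_poch[OF BC, of k1 a 0 k2]
    by (simp_all add: R'_def Bk_def Ck_def B'_def)
  have DE': "mat_commute Dk E'"
    unfolding Dk_def E'_def
    by (rule commute_lists_list_poch_inv[OF DE, of 0, simplified]) (auto intro: inv)
  have DF': "mat_commute Dk F'"
    unfolding Dk_def F'_def
    by (rule commute_lists_list_poch_inv[OF DF, of 0, simplified]) (auto intro: inv)
  have EF': "mat_commute Ek F'"
    unfolding Ek_def F'_def
    by (rule mat_commute_sym, rule commute_lists_list_poch_inv[OF FE, of _ _ 0, simplified])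
       (auto intro: inv)
  have upd: "list_poch ((shift_list k A)[i := Q]) M = R' ** Q'"
    unfolding R'_def Q'_def R_def shift_list_remove_nth[symmetric]
    by (rule list_poch_update)
       (use i Q in \<open>auto simp: shift_list_def intro: mat_commute_shift\<close>)
  have left: "Rk ** R' ** Q' ** (Bk ** B') ** (Ck ** C') = Rk ** Bk ** Ck ** (R' ** Q' ** B' ** C')"
    by (simp only: matrix_mul_assoc[symmetric] mat_commute_left[OF QB] mat_commute_left[OF QC]
        mat_commute_left[OF R'B] mat_commute_left[OF R'C] mat_commute_left[OF B'C])
  have right: "(D' ** Dk) ** (E' ** Ek) ** (F' ** Fk) = D' ** E' ** F' ** (Dk ** Ek ** Fk)"
    by (simp only: matrix_mul_assoc[symmetric] mat_commute_left[OF DE'] mat_commute_left[OF DF']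
        mat_commute_left[OF EF'])
  have "Rk ** R' ** Q' ** (Bk ** B') ** (Ck ** C') ** (D' ** Dk) ** (E' ** Ek) ** (F' ** Fk)
      = Rk ** R' ** Q' ** (Bk ** B') ** (Ck ** C') ** ((D' ** Dk) ** (E' ** Ek) ** (F' ** Fk))"
    by (simp only: matrix_mul_assoc)
  also have "\<dots> = Rk ** Bk ** Ck ** (R' ** Q' ** B' ** C' ** D' ** E' ** F') ** (Dk ** Ek ** Fk)"
    unfolding left right by (simp only: matrix_mul_assoc)
  finally show ?thesis
    unfolding R_def[symmetric] k_def[symmetric] M_def[symmetric] upd
    using inv
    by (simp add: list_poch_add RR BB CC list_poch_inv_add DD EE FF
        Rk_def R'_def Q'_def Bk_def B'_def Ck_def C'_def Dk_def D'_def Ek_def E'_def Fk_def F'_def)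
qed

text \<open>
  Both identities of the theorem are instances: \<open>\<epsilon> = 1\<close> with \<open>P = A\<^sub>i + s I\<close> and \<open>Q k = A\<^sub>i + k I\<close>, and
  \<open>\<epsilon> = -1\<close> with \<open>P = A\<^sub>i - s I\<close> and \<open>Q k = A\<^sub>i\<close>. Convergence of the series on the
  left follows from that of the finitely many series on the right.
\<close>

lemma kdf_expansion:
  fixes A B C D E F :: "'r::finite cmat list"
  assumes AA: "commute_lists A A" and AB: "commute_lists A B" and AC: "commute_lists A C"
    and BC: "commute_lists B C"
    and FE: "commute_lists F E" and DF: "commute_lists D F" and DE: "commute_lists D E"
    and BB: "commute_lists B B" and CC: "commute_lists C C"
    and DD: "commute_lists D D" and EE: "commute_lists E E" and FF: "commute_lists F F"
    and inv: "\<And>P k. P \<in> set D \<union> set E \<union> set F \<Longrightarrow> invertible (shift (int k) P)"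
    and i: "i < length A"
    and P: "\<And>M. M \<in> set A \<Longrightarrow> mat_commute P M"
    and Q: "\<And>k M. M \<in> set A \<union> set B \<union> set C \<Longrightarrow> mat_commute (Q k) M"
    and expand: "\<And>N. mat_poch P N =
      (\<Sum>k\<le>s. (of_nat (s choose k) * (\<epsilon> ^ k * of_nat (fact k * (N choose k)))) *\<^sub>m
        mat_poch (Q k) (N - k))"
    and conv: "\<And>k1 k2. k1 + k2 \<le> s \<Longrightarrow>
      kdf_converges ((shift_list (k1 + k2) A)[i := Q (k1 + k2)]) (shift_list k1 B) (shift_list k2 C)
        (shift_list (k1 + k2) D) (shift_list k1 E) (shift_list k2 F) x y"
  shows "kdf (A[i := P]) B C D E F x y =
    (\<Sum>(k1, k2) \<in> {(k1, k2). k1 + k2 \<le> s}.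
      (trinomial s k1 k2 * (\<epsilon> * x) ^ k1 * (\<epsilon> * y) ^ k2) *\<^sub>m
        (list_poch (remove_nth i A) (k1 + k2) ** list_poch B k1 ** list_poch C k2 **
         kdf ((shift_list (k1 + k2) A)[i := Q (k1 + k2)]) (shift_list k1 B) (shift_list k2 C)
           (shift_list (k1 + k2) D) (shift_list k1 E) (shift_list k2 F) x y **
         list_poch_inv D (k1 + k2) ** list_poch_inv E k1 ** list_poch_inv F k2))"
proof -
  define T where "T = {(k1::nat, k2). k1 + k2 \<le> s}"
  have fin: "finite T"
    by (rule finite_subset[of _ "{..s} \<times> {..s}"]) (auto simp: T_def)
  define t where "t k1 k2 = kdf_term ((shift_list (k1 + k2) A)[i := Q (k1 + k2)]) (shift_list k1 B)
    (shift_list k2 C) (shift_list (k1 + k2) D) (shift_list k1 E) (shift_list k2 F) x y" for k1 k2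
  define L where "L k1 k2 = list_poch (remove_nth i A) (k1 + k2) ** list_poch B k1 **
    list_poch C k2" for k1 k2
  define R where "R k1 k2 = list_poch_inv D (k1 + k2) ** list_poch_inv E k1 **
    list_poch_inv F k2" for k1 k2
  define w where "w k1 k2 = trinomial s k1 k2 * (\<epsilon> * x) ^ k1 * (\<epsilon> * y) ^ k2" for k1 k2
  define h where "h k1 k2 X = w k1 k2 *\<^sub>m (L k1 k2 ** X ** R k1 k2)" for k1 k2 X
  have h0: "h k1 k2 0 = 0" for k1 k2
    using bounded_linear_cscale_sandwich[of "w k1 k2" "L k1 k2" "R k1 k2"]
    unfolding h_def by (rule linear_simps(3))
  have termwise: "kdf_term (A[i := P]) B C D E F x y (m, n) =
      (\<Sum>(k1, k2)\<in>T. h k1 k2 (if k1 \<le> m \<and> k2 \<le> n then t k1 k2 (m - k1, n - k2) else 0))"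
    for m n
  proof -
    define N where "N = m + n"
    define c where "c = x ^ m * y ^ n / (fact m * fact n)"
    define G where "G k = list_poch (remove_nth i A) N ** mat_poch (Q k) (N - k) **
      list_poch B m ** list_poch C n ** list_poch_inv D N ** list_poch_inv E m **
      list_poch_inv F n" for k
    have "kdf_term (A[i := P]) B C D E F x y (m, n) =
        (\<Sum>k\<le>s. (c * (of_nat (s choose k) * (\<epsilon> ^ k * of_nat (fact k * (N choose k))))) *\<^sub>m G k)"
      using list_poch_update[OF i P, of N]
      by (simp add: kdf_term_def c_def G_def expand N_def matrix_mult_sum_left
          matrix_mult_sum_right cscale_sum_right cscale_mult_left cscale_mult_right cscale_cscale)
    also have "\<dots> = (\<Sum>k\<le>s. \<Sum>k1\<le>k. (c * (of_nat (s choose k) * (\<epsilon> ^ k *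
        of_nat (fact k * ((m choose k1) * (n choose (k - k1))))))) *\<^sub>m G k)"
      unfolding N_def
      by (simp only: vandermonde[symmetric] cscale_sum_left[symmetric] sum_distrib_left of_nat_sum)
    \<comment> \<open>\<open>k\<close> is written as \<open>k1 + k2\<close> with \<open>k2 = k - k1\<close>, the shape in which the triangle is reindexed\<close>
    also have "\<dots> = (\<Sum>k\<le>s. \<Sum>k1\<le>k. (c * (of_nat (s choose (k1 + (k - k1))) *
        (\<epsilon> ^ (k1 + (k - k1)) * of_nat (fact (k1 + (k - k1)) *
          ((m choose k1) * (n choose (k - k1))))))) *\<^sub>m G (k1 + (k - k1)))"
      by (intro sum.cong refl) simp
    also have "\<dots> = (\<Sum>(k1, k2)\<in>T. (c * (of_nat (s choose (k1 + k2)) * (\<epsilon> ^ (k1 + k2) *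
        of_nat (fact (k1 + k2) * ((m choose k1) * (n choose k2)))))) *\<^sub>m G (k1 + k2))"
      unfolding T_def by (rule sum.triangle_reindex_eq[symmetric])
    also have "\<dots> = (\<Sum>(k1, k2)\<in>T.
        h k1 k2 (if k1 \<le> m \<and> k2 \<le> n then t k1 k2 (m - k1, n - k2) else 0))"
    proof (intro sum.cong refl, clarify)
      fix k1 k2 assume "(k1, k2) \<in> T"
      then have k: "k1 + k2 \<le> s" by (simp add: T_def)
      show "(c * (of_nat (s choose (k1 + k2)) * (\<epsilon> ^ (k1 + k2) *
          of_nat (fact (k1 + k2) * ((m choose k1) * (n choose k2)))))) *\<^sub>m G (k1 + k2) =
        h k1 k2 (if k1 \<le> m \<and> k2 \<le> n then t k1 k2 (m - k1, n - k2) else 0)"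
      proof (cases "k1 \<le> m \<and> k2 \<le> n")
        case True
        then obtain a b where m: "m = k1 + a" and n: "n = k2 + b"
          by (auto simp: le_iff_add)
        have N: "N = k1 + k2 + (a + b)" by (simp add: N_def m n)
        have "G (k1 + k2) = L k1 k2 **
            (list_poch ((shift_list (k1 + k2) A)[i := Q (k1 + k2)]) (a + b) **
             list_poch (shift_list k1 B) a ** list_poch (shift_list k2 C) b **
             list_poch_inv (shift_list (k1 + k2) D) (a + b) **
             list_poch_inv (shift_list k1 E) a ** list_poch_inv (shift_list k2 F) b) ** R k1 k2"
          unfolding G_def L_def R_def
          using kdf_product_split[OF AA AB AC BC FE DF DE BB CC DD EE FF inv i Q, of k1 k2 a b]
          by (simp only: N m n diff_add_inverse)
        then show ?thesis
          unfolding c_def kdf_coefficient_split[OF k] h_def w_def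
          by (simp add: t_def kdf_term_def m n cscale_mult_left cscale_mult_right cscale_cscale)
      next
        case False
        then show ?thesis
          by (simp only: c_def kdf_coefficient_split[OF k] h0 if_False cscale_zero_left)
      qed
    qed
    finally show ?thesis .
  qed
  have "((\<lambda>p. \<Sum>q\<in>T. case q of (k1, k2) \<Rightarrow> h k1 k2 (case p of (m, n) \<Rightarrow>
          if k1 \<le> m \<and> k2 \<le> n then t k1 k2 (m - k1, n - k2) else 0))
      has_sum (\<Sum>q\<in>T. case q of (k1, k2) \<Rightarrow> h k1 k2 (infsum (t k1 k2) UNIV))) UNIV"
  proof (rule has_sum_finite_sum[OF fin], clarify)
    fix k1 k2 assume "(k1, k2) \<in> T"
    then have "(\<lambda>p. norm (t k1 k2 p)) summable_on UNIV"
      using conv[of k1 k2] by (simp add: T_def t_def kdf_converges_def)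
    then have "(t k1 k2 has_sum infsum (t k1 k2) UNIV) UNIV"
      by (rule has_sum_infsum[OF abs_summable_summable])
    then show "((\<lambda>p. h k1 k2 (case p of (m, n) \<Rightarrow>
          if k1 \<le> m \<and> k2 \<le> n then t k1 k2 (m - k1, n - k2) else 0))
        has_sum h k1 k2 (infsum (t k1 k2) UNIV)) UNIV"
      unfolding h_def
      by (intro has_sum_bounded_linear[OF bounded_linear_cscale_sandwich] has_sum_translate)
  qed
  moreover have "kdf_term (A[i := P]) B C D E F x y =
      (\<lambda>p. \<Sum>q\<in>T. case q of (k1, k2) \<Rightarrow> h k1 k2 (case p of (m, n) \<Rightarrow>
          if k1 \<le> m \<and> k2 \<le> n then t k1 k2 (m - k1, n - k2) else 0))"
    by (auto simp: fun_eq_iff termwise)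
  ultimately have "kdf (A[i := P]) B C D E F x y =
      (\<Sum>q\<in>T. case q of (k1, k2) \<Rightarrow> h k1 k2 (infsum (t k1 k2) UNIV))"
    unfolding kdf_def by (simp only: infsumI)
  then show ?thesis
    by (simp only: T_def h_def w_def L_def R_def t_def kdf_def matrix_mul_assoc)
qed

theorem theorem2p2:
  fixes A B C D E F :: "(complex ^ 'r ^ 'r) list"
    and x y :: complex and s i :: nat
  assumes stable: "\<forall>P \<in> set A \<union> set B \<union> set C \<union> set D \<union> set E \<union> set F. positive_stable P"
    and AA: "commute_lists A A" and AB: "commute_lists A B" and AC: "commute_lists A C"
    and BC: "commute_lists B C"
    and FE: "commute_lists F E" and DF: "commute_lists D F" and DE: "commute_lists D E"
    and BB: "commute_lists B B" and CC: "commute_lists C C"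
    and DD: "commute_lists D D" and EE: "commute_lists E E" and FF: "commute_lists F F"
    and inv_DEF: "\<forall>P \<in> set D \<union> set E \<union> set F. \<forall>k::nat. invertible (shift (int k) P)"
    and inv_A: "\<forall>P \<in> set A. \<forall>k::nat. invertible (shift (int k) P)"
    and i: "i < length A"
  shows
    "(kdf_converges (A[i := shift (int s) (A ! i)]) B C D E F x y \<and>
      (\<forall>k1 k2. k1 + k2 \<le> s \<longrightarrow>
         kdf_converges (shift_list (k1 + k2) A) (shift_list k1 B) (shift_list k2 C)
           (shift_list (k1 + k2) D) (shift_list k1 E) (shift_list k2 F) x y) \<longrightarrow>
      kdf (A[i := shift (int s) (A ! i)]) B C D E F x y =
      (\<Sum>(k1, k2) \<in> {(k1, k2). k1 + k2 \<le> s}.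
         (trinomial s k1 k2 * x ^ k1 * y ^ k2) *\<^sub>m
           (list_poch (remove_nth i A) (k1 + k2) ** list_poch B k1 ** list_poch C k2 **
            kdf (shift_list (k1 + k2) A) (shift_list k1 B) (shift_list k2 C)
              (shift_list (k1 + k2) D) (shift_list k1 E) (shift_list k2 F) x y **
            list_poch_inv D (k1 + k2) ** list_poch_inv E k1 ** list_poch_inv F k2)))
     \<and>
     ((\<forall>k::int. k \<le> int s \<longrightarrow> invertible (shift (- k) (A ! i))) \<and>
      kdf_converges (A[i := shift (- int s) (A ! i)]) B C D E F x y \<and>
      (\<forall>k1 k2. k1 + k2 \<le> s \<longrightarrow>
         kdf_converges ((shift_list (k1 + k2) A)[i := A ! i]) (shift_list k1 B) (shift_list k2 C)
           (shift_list (k1 + k2) D) (shift_list k1 E) (shift_list k2 F) x y) \<longrightarrow>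
      kdf (A[i := shift (- int s) (A ! i)]) B C D E F x y =
      (\<Sum>(k1, k2) \<in> {(k1, k2). k1 + k2 \<le> s}.
         (trinomial s k1 k2 * (- x) ^ k1 * (- y) ^ k2) *\<^sub>m
           (list_poch (remove_nth i A) (k1 + k2) ** list_poch B k1 ** list_poch C k2 **
            kdf ((shift_list (k1 + k2) A)[i := A ! i]) (shift_list k1 B) (shift_list k2 C)
              (shift_list (k1 + k2) D) (shift_list k1 E) (shift_list k2 F) x y **
            list_poch_inv D (k1 + k2) ** list_poch_inv E k1 ** list_poch_inv F k2)))"
proof -
  have inv: "invertible (shift (int k) P)" if "P \<in> set D \<union> set E \<union> set F" for P k
    using inv_DEF that by blast
  have Ai: "mat_commute (A ! i) M" if "M \<in> set A \<union> set B \<union> set C" for M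
    using that commute_listsD[OF AA] commute_listsD[OF AB] commute_listsD[OF AC] nth_mem[OF i]
    by auto
  have shift_Ai: "mat_commute (shift k (A ! i)) M" if "M \<in> set A \<union> set B \<union> set C" for k M
    using Ai[OF that] by (blast intro: mat_commute_sym mat_commute_shift)
  have self: "(shift_list k A)[i := shift (int k) (A ! i)] = shift_list k A" for k
    using i by (simp add: shift_list_def list_update_same_conv)
  note expansion = kdf_expansion[OF AA AB AC BC FE DF DE BB CC DD EE FF _ i]
  show ?thesis (is "(_ \<and> ?conv1 \<longrightarrow> ?eq1) \<and> (_ \<and> _ \<and> ?conv2 \<longrightarrow> ?eq2)")
  proof (intro conjI impI; elim conjE)
    assume conv: ?conv1
    show ?eq1
      by (subst expansion[where Q = "\<lambda>k. shift (int k) (A ! i)", OF _ _ _ mat_poch_shift_up])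
         (use inv shift_Ai conv in \<open>auto simp: self simp del: of_nat_add\<close>)
  next
    assume conv: ?conv2
    show ?eq2
      by (subst expansion[where Q = "\<lambda>k. A ! i", OF _ _ _ mat_poch_shift_down])
         (use inv Ai shift_Ai conv in auto)
  qed
qed

end
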